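(* Let $s\ge 1$ and let $S=\{x^2+c_1, x^2+c_2,\dots,x^2+c_s\}$ for some pairwise distinct $c_1,\dots,c_s\in\mathbb{Q}$. Suppose that $\mu_S(\mathbb{Q})\le 3$, i.e. no polynomial in $S$ has a point of $\mathbb{P}^1(\mathbb{Q})$ of exact period greater than $3$. Then: (1) If $\#S=3$ and $P\in\mathbb{Q}$ has finite orbit for $S$, then either $S=\{x^2-\tfrac{5}{16},\ x^2-\tfrac{13}{16},\ x^2-\tfrac{21}{16}\}$ and $P\in\{\pm\tfrac14,\pm\tfrac34,\pm\tfrac54\}$, or $S=\{x^2+\tfrac{3}{16},\ x^2-\tfrac{5}{16},\ x^2-\tfrac{13}{16}\}$ and $P\in\{\pm\tfrac14,\pm\tfrac34\}$. (2) If $\#S\ge 4$, then there is no point $P\in\mathbb{Q}$ with finite orbit for $S$.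
   Context: For a finite set $S$ of rational functions over $\mathbb{Q}$, let $M_S$ be the monoid of all finite compositions $\phi_n\circ\cdots\circ\phi_1$ ($n\ge1$, $\phi_i\in S$). The orbit of $P\in\mathbb{P}^1(\mathbb{Q})$ for $S$ is $\mathrm{Orb}_S(P)=\{\rho(P):\rho\in M_S\}$, and $P$ has finite orbit for $S$ if this set is finite. A point $P$ has exact period $n$ for $\phi$ if $\phi^n(P)=P$ and $\phi^m(P)\ne P$ for $0<m<n$. The quantity $\mu_S(\mathbb{Q})$ is the supremum of all $n$ such that some $\phi\in S$ has a point of $\mathbb{P}^1(\mathbb{Q})$ of exact period $n$. *)

theory Defs
  imports
    "HOL-Computational_Algebra.Computational_Algebra"
    "HOL-Computational_Algebra.Field_as_Ring"
    "HOL-Library.Extended_Nat"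
begin

(* The projective line K \<union> {\<infinity>}: Affine x is the point [x : 1], Infinity is [1 : 0]. *)
datatype 'a proj_line = Affine 'a | Infinity

type_synonym ratfun = "rat poly fract"

(* The self-map of the projective line over the rationals induced by p/q in lowest terms,
   i.e. [x : y] |-> [P(x, y) : Q(x, y)], where P and Q are the homogenisations of p and q
   in degree max (degree p) (degree q). The value at Infinity is the ratio of the
   coefficients of p and q in that degree. *)
definition ratfun_map :: "ratfun \<Rightarrow> rat proj_line \<Rightarrow> rat proj_line" where
  "ratfun_map \<phi> P =
    (let (p, q) = quot_of_fract \<phi> in
     case P of
       Affine x \<Rightarrow> if poly q x = 0 then Infinity else Affine (poly p x / poly q x)
     | Infinity \<Rightarrow> if degree p > degree q then Infinity
                   else Affine (coeff p (degree q) / lead_coeff q))"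

(* Elements of the monoid are recorded as self-maps of the projective line; as the rationals
   are infinite, a rational function is determined by its map. There is no identity unless
   it arises as a nonempty composition. *)
inductive_set comp_monoid :: "ratfun set \<Rightarrow> (rat proj_line \<Rightarrow> rat proj_line) set"
  for S :: "ratfun set" where
  generator: "\<phi> \<in> S \<Longrightarrow> ratfun_map \<phi> \<in> comp_monoid S"
| compose: "\<phi> \<in> S \<Longrightarrow> \<rho> \<in> comp_monoid S \<Longrightarrow> ratfun_map \<phi> \<circ> \<rho> \<in> comp_monoid S"

definition orbit_of :: "ratfun set \<Rightarrow> rat proj_line \<Rightarrow> rat proj_line set" where
  "orbit_of S P = {\<rho> P | \<rho>. \<rho> \<in> comp_monoid S}"

definition has_finite_orbit :: "ratfun set \<Rightarrow> rat proj_line \<Rightarrow> bool" where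
  "has_finite_orbit S P \<longleftrightarrow> finite (orbit_of S P)"

definition has_exact_period :: "ratfun \<Rightarrow> nat \<Rightarrow> rat proj_line \<Rightarrow> bool" where
  "has_exact_period \<phi> n P \<longleftrightarrow>
     n \<ge> 1 \<and> (ratfun_map \<phi> ^^ n) P = P \<and>
     (\<forall>m. 0 < m \<and> m < n \<longrightarrow> (ratfun_map \<phi> ^^ m) P \<noteq> P)"

definition max_period :: "ratfun set \<Rightarrow> enat" where
  "max_period S = Sup {enat n | n. \<exists>\<phi>\<in>S. \<exists>P. has_exact_period \<phi> n P}"

definition quad :: "rat \<Rightarrow> ratfun" where
  "quad c = to_fract [:c, 0, 1:]"

end

theory Submission imports Defs Complex_Main begin

text \<open>
  A point with finite orbit yields a finite set \<open>X = -X\<close> of rationals mapped to itself by all the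
  maps \<open>x\<^sup>2 + c\<close>, \<open>c \<in> C\<close>. If some element of \<open>X\<close> is not integral at the prime \<open>p\<close>, then all have
  the same norm, and \<open>X\<close> lies in two opposite \<open>p\<close>-adic discs on which the maps expand distances by
  the factor \<open>q = |2x|\<close> (when this exceeds \<open>1\<close>). For odd \<open>p\<close>, coding points by the discs that their
  iterates visit shows that three parameters cannot coexist, so the sums and differences in \<open>X\<close> are
  integral away from \<open>2\<close>. At \<open>2\<close> the discs show that for \<open>x, y \<in> X\<close> one of \<open>x - y\<close>, \<open>x + y\<close> is an
  integer; hence among three parameters two differ by a nonzero integer. For the real absolute
  value, parameters at distance at least \<open>1\<close> leave room only for the two listed configurations.
\<close>

section \<open>Nonarchimedean norms and multiplicative residue classes\<close>

locale nonarchimedean =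
  fixes N :: "'a::field \<Rightarrow> real"
  assumes N_zero [simp]: "N 0 = 0"
    and N_pos: "x \<noteq> 0 \<Longrightarrow> N x > 0"
    and N_mult: "N (x * y) = N x * N y"
    and N_add: "N (x + y) \<le> max (N x) (N y)"
begin


lemma N_nonneg [simp]: "N x \<ge> 0"
  using N_pos[of x] by (cases "x = 0") auto

lemma N_eq_0 [simp]: "N x = 0 \<longleftrightarrow> x = 0"
  using N_pos[of x] by (cases "x = 0") auto

lemma N_one [simp]: "N 1 = 1"
  using N_mult[of 1 1] by simp

lemma N_minus [simp]: "N (- x) = N x"
proof -
  have "N (-1) * N (-1) = 1"
    by (simp flip: N_mult)
  then have "N (-1) = 1 \<or> N (-1) = -1"
    by (simp add: square_eq_1_iff)
  then have "N (-1) = 1"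
    using N_nonneg[of "-1"] by linarith
  then show ?thesis
    using N_mult[of "-1" x] by simp
qed

lemma N_diff: "N (x - y) \<le> max (N x) (N y)"
  using N_add[of x "- y"] by simp

lemma N_diff_commute: "N (x - y) = N (y - x)"
proof -
  have "N (x - y) = N (- (y - x))"
    by (simp only: minus_diff_eq)
  then show ?thesis
    by (simp only: N_minus)
qed

lemma N_power: "N (x ^ n) = N x ^ n"
  by (induction n) (auto simp: N_mult)

text \<open>Isosceles principle: each of \<open>x\<close> and \<open>y\<close> is the other plus a
  perturbation of norm below \<open>N y\<close>, so neither norm can exceed the other.\<close>

lemma N_close:
  assumes "N (x - y) < N y"
  shows "N x = N y"
proof -
  have "N x \<le> max (N (x - y)) (N y)"
    using N_add[of "x - y" y] by (simp only: diff_add_cancel)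
  moreover have "x - (x - y) = y"
    by simp
  then have "N y \<le> max (N x) (N (x - y))"
    using N_diff[of x "x - y"] by (simp only:)
  ultimately show ?thesis
    using assms by linarith
qed

text \<open>For nonzero \<open>y\<close> this says that \<open>x / y - 1\<close> has norm below 1.
  The classes are thus the cosets of the principal units in the multiplicative group, which is why
  they respect products and cancellation. The relation never holds at 0.\<close>

definition sim :: "'a \<Rightarrow> 'a \<Rightarrow> bool" where
  "sim x y \<longleftrightarrow> N (x - y) < N y"

lemma sim_N: "sim x y \<Longrightarrow> N x = N y"
  unfolding sim_def by (rule N_close)

lemma sim_sym: "sim x y \<Longrightarrow> sim y x"
  unfolding sim_def using N_close[of x y] N_diff_commute[of x y] by linarith

lemma sim_trans [trans]:
  assumes "sim x y" "sim y z"
  shows "sim x z"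
proof -
  have "N (x - z) \<le> max (N (x - y)) (N (y - z))"
    using N_add[of "x - y" "y - z"] by simp
  then show ?thesis
    using assms sim_N[OF assms(2)] unfolding sim_def by linarith
qed

lemma sim_refl: "x \<noteq> 0 \<Longrightarrow> sim x x"
  by (simp add: sim_def N_pos)

lemma sim_nonzero: "sim x y \<Longrightarrow> x \<noteq> 0 \<and> y \<noteq> 0"
  using sim_N[of x y] N_nonneg[of "x - y"] N_eq_0 unfolding sim_def by (metis N_zero not_less)

lemma sim_mult_cancel: "c \<noteq> 0 \<Longrightarrow> sim (x * c) (y * c) \<longleftrightarrow> sim x y"
proof -
  assume "c \<noteq> 0"
  moreover have "x * c - y * c = (x - y) * c"
    by (simp add: left_diff_distrib)
  ultimately show ?thesis
    using N_pos[of c] by (simp add: sim_def N_mult)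
qed

lemma sim_mult_cancel_left: "c \<noteq> 0 \<Longrightarrow> sim (c * x) (c * y) \<longleftrightarrow> sim x y"
  using sim_mult_cancel[of c x y] by (simp add: mult.commute)

lemma sim_mult:
  assumes "sim x y" "sim u v"
  shows "sim (x * u) (y * v)"
proof -
  have "u \<noteq> 0" "y \<noteq> 0"
    using assms sim_nonzero by auto
  then have "sim (x * u) (y * u)"
    by (simp add: sim_mult_cancel assms)
  also have "sim (u * y) (v * y)"
    using \<open>y \<noteq> 0\<close> by (simp add: sim_mult_cancel assms)
  then have "sim (y * u) (y * v)"
    by (simp add: mult.commute)
  finally show ?thesis .
qed

lemma sim_prod:
  assumes "finite A" "\<And>i. i \<in> A \<Longrightarrow> sim (g i) (h i)"
  shows "sim (prod g A) (prod h A)"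
  using assms by (induction A rule: finite_induct) (auto intro: sim_refl sim_mult)

end

section \<open>Expanding quadratic maps on two opposite discs\<close>

abbreviation qmap :: "'a::comm_ring_1 \<Rightarrow> 'a \<Rightarrow> 'a" where
  "qmap c x \<equiv> x ^ 2 + c"

text \<open>Telescopes \<open>u^2 - v^2 = (u - v) * (u + v)\<close>; an exact form of the chain
  rule.\<close>

lemma qmap_iterate_diff:
  "(qmap c ^^ n) x - (qmap c ^^ n) y =
     (x - y) * (\<Prod>i<n. (qmap c ^^ i) x + (qmap c ^^ i) y)"
proof (induction n)
  case (Suc n)
  have "(qmap c ^^ Suc n) x - (qmap c ^^ Suc n) y =
      ((qmap c ^^ n) x - (qmap c ^^ n) y) * ((qmap c ^^ n) x + (qmap c ^^ n) y)"
    by (simp add: algebra_simps power2_eq_square)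
  then show ?case
    by (simp add: Suc.IH mult.assoc)
qed simp

text \<open>\<open>q\<close> is the common norm of the derivative \<open>2 * x\<close> on
  \<open>X\<close>. Since \<open>2 * x = (x - y) + (x + y)\<close>, two points of \<open>X\<close>
  are at distance \<open>q\<close> from each other or from each other's negatives. At the prime 2
  the bound \<open>N_diff_le\<close> is stronger than the ultrametric inequality, as
  \<open>q\<close> is then smaller than \<open>N x\<close>.\<close>

locale split_orbit = nonarchimedean N for N :: "'a::field \<Rightarrow> real" +
  fixes X C :: "'a set" and q :: real
  assumes q_gt_1: "q > 1"
    and closed: "x \<in> X \<Longrightarrow> c \<in> C \<Longrightarrow> qmap c x \<in> X"
    and uminus_closed: "x \<in> X \<Longrightarrow> - x \<in> X"
    and N_double: "x \<in> X \<Longrightarrow> N (2 * x) = q"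
    and N_diff_le: "x \<in> X \<Longrightarrow> y \<in> X \<Longrightarrow> N (x - y) \<le> q"
begin


lemma N_sum_le: "x \<in> X \<Longrightarrow> y \<in> X \<Longrightarrow> N (x + y) \<le> q"
  using N_diff_le[of x "- y"] uminus_closed by simp

lemma N_sum_eq:
  assumes "x \<in> X" "y \<in> X" "N (x - y) < q"
  shows "N (x + y) = q"
proof -
  have "(x - y) + (x + y) = 2 * x"
    by simp
  then have "q \<le> max (N (x - y)) (N (x + y))"
    using N_add[of "x - y" "x + y"] N_double[OF assms(1)] by metis
  then have "q \<le> N (x + y)"
    using assms(3) by (simp add: le_max_iff_disj)
  then show ?thesis
    using N_sum_le[OF assms(1,2)] by (rule antisym[rotated])
qed

lemma N_qmap_diff:
  "N (qmap c x - qmap c y) = N (x - y) * N (x + y)"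
proof -
  have "qmap c x - qmap c y = (x - y) * (x + y)"
    by (simp add: algebra_simps power2_eq_square)
  then have "N (qmap c x - qmap c y) = N ((x - y) * (x + y))"
    by (rule arg_cong)
  then show ?thesis
    by (rule trans) (rule N_mult)
qed

lemma N_qmap_diff_close:
  "x \<in> X \<Longrightarrow> y \<in> X \<Longrightarrow> N (x - y) < q \<Longrightarrow> N (qmap c x - qmap c y) = q * N (x - y)"
  unfolding N_qmap_diff by (simp add: N_sum_eq)

text \<open>One application of \<open>qmap c\<close> multiplies the distance by \<open>q\<close>,
  yet the images are still at distance at most \<open>q\<close>.\<close>

lemma N_diff_le_1:
  assumes "x \<in> X" "y \<in> X" "N (x - y) < q" "c \<in> C"
  shows "N (x - y) \<le> 1"
proof -
  have "q * N (x - y) \<le> q"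
    using N_qmap_diff_close[OF assms(1-3), of c] N_diff_le[of "qmap c x" "qmap c y"]
      closed assms by simp
  then show ?thesis
    using q_gt_1 by simp
qed

lemma N_sum_le_1:
  assumes "x \<in> X" "y \<in> X" "N (x - y) = q" "c \<in> C"
  shows "N (x + y) \<le> 1"
proof -
  have "q * N (x + y) \<le> q"
    using N_qmap_diff[of x c y] N_diff_le[of "qmap c x" "qmap c y"] closed assms by simp
  then show ?thesis
    using q_gt_1 by simp
qed

text \<open>Being far from \<open>x\<close> means being near \<open>- x\<close>, so \<open>y\<close>
  and \<open>z\<close> would be near each other.\<close>

lemma no_three_far_points:
  assumes "x \<in> X" "y \<in> X" "z \<in> X" "c \<in> C"
    and "N (x - y) = q" "N (x - z) = q" "N (y - z) = q"
  shows False
proof -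
  have "N (x + y) \<le> 1" "N (x + z) \<le> 1"
    using N_sum_le_1 assms by blast+
  then have "N ((x + y) - (x + z)) \<le> 1"
    by (intro order.trans[OF N_diff] max.boundedI)
  then show False
    using assms(7) q_gt_1 by simp
qed

lemma iterate_closed: "x \<in> X \<Longrightarrow> c \<in> C \<Longrightarrow> (qmap c ^^ n) x \<in> X"
  by (induction n) (auto intro: closed)

lemma N_iterate_diff:
  assumes "u \<in> X" "v \<in> X" "c \<in> C"
    and "\<And>i. i < n \<Longrightarrow> N ((qmap c ^^ i) u - (qmap c ^^ i) v) < q"
  shows "N ((qmap c ^^ n) u - (qmap c ^^ n) v) = q ^ n * N (u - v)"
  using assms(4)
proof (induction n)
  case (Suc n)
  let ?u = "(qmap c ^^ n) u" and ?v = "(qmap c ^^ n) v"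
  have "N (qmap c ?u - qmap c ?v) = q * N (?u - ?v)"
    using N_qmap_diff_close iterate_closed assms(1-3) Suc.prems[of n] by blast
  then show ?case
    using Suc.IH Suc.prems by simp
qed simp

text \<open>The itinerary through the two discs determines the point: while the iterates stay close,
  their distance grows by the factor \<open>q\<close> each time, and it is bounded.\<close>

lemma eq_if_iterates_close:
  assumes "u \<in> X" "v \<in> X" "c \<in> C"
    and "\<And>i. N ((qmap c ^^ i) u - (qmap c ^^ i) v) < q"
  shows "u = v"
proof (rule ccontr)
  assume "u \<noteq> v"
  then have "N (u - v) > 0"
    using N_pos by simp
  then obtain n where "q / N (u - v) < q ^ n"
    using real_arch_pow[OF q_gt_1] by blast
  then have "q < q ^ n * N (u - v)"
    using \<open>N (u - v) > 0\<close> by (simp add: field_simps)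
  moreover have "q ^ n * N (u - v) < q"
    using N_iterate_diff[OF assms(1-3), of n] assms(4)[of n] assms(4) by simp
  ultimately show False by simp
qed

text \<open>The exponent is the first time at which the two orbits lie in different discs; up to
  then the distance is multiplied by exactly \<open>q\<close> at each step.\<close>

lemma N_diff_power:
  assumes "u \<in> X" "v \<in> X" "c \<in> C" "u \<noteq> v"
  obtains n where "q ^ n * N (u - v) = q"
proof -
  let ?d = "\<lambda>i. N ((qmap c ^^ i) u - (qmap c ^^ i) v)"
  have le: "?d i \<le> q" for i
    using N_diff_le iterate_closed assms by simp
  have "\<not> (\<forall>i. ?d i < q)"
    using eq_if_iterates_close[of u v c] assms by blast
  then obtain k where "q \<le> ?d k"
    by (auto simp: not_less)
  then have "?d k = q"
    using le by (simp add: antisym)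
  define n where "n = (LEAST i. ?d i = q)"
  have "?d n = q"
    unfolding n_def using \<open>?d k = q\<close> by (rule LeastI)
  moreover have "?d i < q" if "i < n" for i
    using not_less_Least[of i "\<lambda>i. ?d i = q"] that le[of i] unfolding n_def by linarith
  ultimately have "q ^ n * N (u - v) = q"
    using N_iterate_diff[OF assms(1-3), of n] by simp
  then show ?thesis by (rule that)
qed

text \<open>The closeness that \<open>N_iterate_diff\<close> demands at earlier times follows from
  the formula itself at those times, hence the strong induction.\<close>

lemma N_iterate_diff_le:
  assumes "u \<in> X" "v \<in> X" "c \<in> C" "q ^ n * N (u - v) \<le> q" "i \<le> n"
  shows "N ((qmap c ^^ i) u - (qmap c ^^ i) v) = q ^ i * N (u - v)"
  using assms(5)
proof (induction i rule: less_induct)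
  case (less i)
  have small: "q ^ j * N (u - v) < q" if "j < i" for j
  proof (cases "u = v")
    case False
    have "q ^ j < q ^ n"
      using that less.prems q_gt_1 by (simp add: power_strict_increasing)
    then have "q ^ j * N (u - v) < q ^ n * N (u - v)"
      using False N_pos[of "u - v"] by simp
    then show ?thesis
      using assms(4) by linarith
  qed (use q_gt_1 in simp)
  show ?case
  proof (rule N_iterate_diff[OF assms(1-3)])
    fix j assume "j < i"
    then show "N ((qmap c ^^ j) u - (qmap c ^^ j) v) < q"
      using less.IH[of j] less.prems small[of j] by simp
  qed
qed

end

section \<open>Odd residue characteristic: at most two parameters\<close>

locale odd_split_orbit = split_orbit +
  assumes N_two: "N 2 = 1"
begin


lemma N_eq_q: "x \<in> X \<Longrightarrow> N x = q"
  using N_double[of x] N_two by (simp add: N_mult)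

lemma nonzero: "x \<in> X \<Longrightarrow> x \<noteq> 0"
  using N_eq_q[of x] q_gt_1 by auto

lemma sim_iff: "x \<in> X \<Longrightarrow> y \<in> X \<Longrightarrow> sim x y \<longleftrightarrow> N (x - y) < q"
  by (simp add: sim_def N_eq_q)

text \<open>\<open>x^2 + c\<close> has norm only \<open>q\<close>, while \<open>x^2\<close> has norm
  \<open>q^2\<close>, so \<open>c\<close> cancels \<open>x^2\<close> to leading order.\<close>

lemma sim_square:
  assumes "x \<in> X" "c \<in> C"
  shows "sim (x ^ 2) (- c)"
proof -
  have *: "N (x\<^sup>2 - (-c)) < N (x ^ 2)"
    using N_eq_q[OF closed[OF assms]] N_eq_q[OF assms(1)] q_gt_1
    by (simp add: N_power power2_eq_square N_mult)
  then show ?thesis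
    by (metis N_diff_commute sim_def sim_sym)
qed

text \<open>The product of the first \<open>n + 1\<close> iterates records the product of the residue classes
  they visit. For a starting point in the image of \<open>qmap c\<close> it does not depend on that point:
  the first index at which the iterates of \<open>qmap c x\<close> and \<open>qmap d x\<close> part is \<open>n\<close>, and there the
  chain rule determines the product from \<open>c - d\<close>.\<close>
lemma prod_iterates_sim:
  assumes "x \<in> X" "c \<in> C" "d \<in> C" "q ^ n * N (c - d) = q"
  shows "sim (\<Prod>i\<le>n. (qmap c ^^ i) (qmap c x)) (- (2 * c) / ((c - d) * 2 ^ n))"
proof -
  define y z where "y = qmap c x" and "z = qmap d x"
  let ?y = "\<lambda>i. (qmap c ^^ i) y" and ?z = "\<lambda>i. (qmap c ^^ i) z"
  have yz: "y \<in> X" "z \<in> X" and diff: "y - z = c - d"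
    using assms closed by (auto simp: y_def z_def)
  have Y: "?y i \<in> X" and Z: "?z i \<in> X" for i
    using iterate_closed yz assms by auto
  have dist: "N (?y i - ?z i) = q ^ i * N (c - d)" if "i \<le> n" for i
    using N_iterate_diff_le[of y z c n i] yz diff assms that by simp
  have two: "N (2 * ?y i) = q" for i
    using N_double Y by simp
  have cd: "c - d \<noteq> 0"
    using assms(4) q_gt_1 by auto
  have two_ne: "(2::'a) \<noteq> 0"
    using N_two by auto
  have close: "sim (?y i + ?z i) (2 * ?y i)" if "i < n" for i
  proof -
    have "q ^ i * N (c - d) < q ^ n * N (c - d)"
      using that q_gt_1 cd N_pos by (simp add: power_strict_increasing)
    then have "N (?z i - ?y i) < q"
      using dist[of i] that assms(4) by (simp add: N_diff_commute)
    moreover have "(?y i + ?z i) - 2 * ?y i = ?z i - ?y i"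
      by simp
    ultimately show ?thesis
      unfolding sim_def two by metis
  qed
  \<comment> \<open>At time \<open>n\<close> the points are in opposite discs, so
    \<open>?z n\<close> is close to \<open>- ?y n\<close> and the difference is close to
    \<open>2 * ?y n\<close>.\<close>
  have "N (?y n - ?z n) = q"
    using dist[of n] assms(4) by simp
  then have "N (?y n + ?z n) < q"
    using N_sum_le_1[OF Y Z, of n n c] assms q_gt_1 by simp
  moreover have "N ((?y n - ?z n) - 2 * ?y n) = N (?y n + ?z n)"
    using N_minus[of "?y n + ?z n"] by (simp add: algebra_simps)
  ultimately have "sim (?y n - ?z n) (2 * ?y n)"
    unfolding sim_def two by metis
  then have "sim (2 * ?y n) ((c - d) * (\<Prod>i<n. ?y i + ?z i))"
    using qmap_iterate_diff[of n c y z] diff sim_sym by simp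
  also have "sim \<dots> ((c - d) * (\<Prod>i<n. 2 * ?y i))"
    by (intro sim_mult sim_prod sim_refl) (use cd close in auto)
  also have "\<dots> = (c - d) * 2 ^ n * (\<Prod>i<n. ?y i)"
    by (simp add: prod.distrib)
  \<comment> \<open>The extra factor \<open>?y n\<close> completes the product on the right and
    produces \<open>(?y n)^2\<close> on the left, whose class is that of \<open>- c\<close> whatever
    the starting point.\<close>
  finally have "sim (2 * ?y n * ?y n) ((c - d) * 2 ^ n * (\<Prod>i<n. ?y i) * ?y n)"
    using sim_mult_cancel nonzero[OF Y] by blast
  moreover have "(c - d) * 2 ^ n * (\<Prod>i<n. ?y i) * ?y n = (\<Prod>i\<le>n. ?y i) * ((c - d) * 2 ^ n)"
    by (simp add: mult_ac flip: lessThan_Suc_atMost)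
  ultimately have "sim ((\<Prod>i\<le>n. ?y i) * ((c - d) * 2 ^ n)) (2 * ?y n * ?y n)"
    by (simp only: sim_sym)
  also have "2 * ?y n * ?y n = 2 * (?y n)\<^sup>2"
    by (simp add: power2_eq_square)
  also have "sim \<dots> (2 * - c)"
    by (rule sim_mult[OF sim_refl[OF two_ne] sim_square[OF Y[of n] assms(2)]])
  finally have "sim ((\<Prod>i\<le>n. ?y i) * ((c - d) * 2 ^ n)) (- (2 * c))"
    by simp
  moreover have "(c - d) * 2 ^ n \<noteq> 0"
    using cd two_ne by simp
  ultimately have "sim (\<Prod>i\<le>n. ?y i) (- (2 * c) / ((c - d) * 2 ^ n))"
    by (metis nonzero_eq_divide_eq sim_mult_cancel)
  then show ?thesis
    by (simp add: y_def)
qed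

text \<open>The class of the iterate of index \<open>n + 1\<close> is determined by those of the iterates
  of indices \<open>0, ..., n\<close>, because the product over the indices \<open>1, ..., n + 1\<close> is known.\<close>
lemma iterates_sim:
  assumes "c \<in> C" "d \<in> C" "q ^ n * N (c - d) = q" "u \<in> X" "v \<in> X"
    and "\<And>i. i \<le> n \<Longrightarrow> sim ((qmap c ^^ i) u) ((qmap c ^^ i) v)"
  shows "sim ((qmap c ^^ i) u) ((qmap c ^^ i) v)"
proof (induction i rule: less_induct)
  case (less i)
  show ?case
  proof (cases "i \<le> n")
    case False
    define k where "k = i - Suc n"
    have i: "i = Suc n + k"
      using False by (simp add: k_def)
    define a b where "a = (qmap c ^^ k) u" and "b = (qmap c ^^ k) v"
    have ab: "a \<in> X" "b \<in> X"
      using iterate_closed assms by (auto simp: a_def b_def)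
    have shift: "(qmap c ^^ j) a = (qmap c ^^ (j + k)) u" "(qmap c ^^ j) b = (qmap c ^^ (j + k)) v" for j
      by (simp_all add: a_def b_def funpow_add)
    have ih: "sim ((qmap c ^^ j) a) ((qmap c ^^ j) b)" if "j \<le> n" for j
      using less[of "j + k"] that unfolding shift i by simp
    let ?Q = "\<lambda>z. \<Prod>j\<le>n. (qmap c ^^ j) z"
    \<comment> \<open>Both sides are the product over the indices \<open>0, ..., n + 1\<close>, with
      the first or the last factor split off.\<close>
    have Q: "z * ?Q (qmap c z) = ?Q z * (qmap c ^^ Suc n) z" for z
    proof -
      have "z * ?Q (qmap c z) = (\<Prod>j\<le>Suc n. (qmap c ^^ j) z)"
        by (subst prod.atMost_Suc_shift) (simp add: funpow_Suc_right del: funpow.simps)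
      then show ?thesis by simp
    qed
    have Qab: "sim (?Q a) (?Q b)"
      by (intro sim_prod) (use ih in auto)
    have "sim (?Q (qmap c a)) (?Q (qmap c b))"
      by (rule sim_trans[OF prod_iterates_sim[OF ab(1) assms(1-3)]
            sim_sym[OF prod_iterates_sim[OF ab(2) assms(1-3)]]])
    moreover have "sim a b"
      using ih[of 0] by simp
    ultimately have "sim (a * ?Q (qmap c a)) (b * ?Q (qmap c b))"
      by (rule sim_mult[rotated])
    then have "sim (?Q a * (qmap c ^^ Suc n) a) (?Q b * (qmap c ^^ Suc n) b)"
      unfolding Q .
    also have "sim \<dots> (?Q a * (qmap c ^^ Suc n) b)"
      by (rule sim_mult[OF sim_sym[OF Qab] sim_refl[OF nonzero[OF iterate_closed[OF ab(2) assms(1)]]]])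
    finally have "sim ((qmap c ^^ Suc n) a) ((qmap c ^^ Suc n) b)"
      using sim_nonzero[OF Qab] sim_mult_cancel_left by blast
    then show ?thesis
      unfolding shift i .
  qed (use assms in auto)
qed

text \<open>Otherwise \<open>qmap c x\<close> and \<open>qmap d x\<close> share their classes under
  \<open>qmap b\<close> up to the time \<open>n\<close> attached to \<open>b - c\<close>. By
  \<open>iterates_sim\<close> they then share them forever, which forces
  \<open>c = d\<close>.\<close>

lemma N_param_diff_ge:
  assumes "x \<in> X" "b \<in> C" "c \<in> C" "d \<in> C" "b \<noteq> c" "c \<noteq> d"
  shows "N (b - c) \<le> N (c - d)"
proof (rule ccontr)
  assume less: "\<not> N (b - c) \<le> N (c - d)"
  obtain n where n: "q ^ n * N (b - c) = q"
    using N_diff_power[of "qmap b x" "qmap c x" b] closed assms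
    by (metis add_diff_cancel_left add_left_imp_eq)
  define u v where "u = qmap c x" and "v = qmap d x"
  have uv: "u \<in> X" "v \<in> X" "u - v = c - d" "u \<noteq> v"
    using closed assms by (auto simp: u_def v_def)
  have "sim ((qmap b ^^ i) u) ((qmap b ^^ i) v)" if "i \<le> n" for i
  proof -
    have "q ^ i \<le> q ^ n"
      using that q_gt_1 by (simp add: power_increasing)
    then have "q ^ i * N (u - v) \<le> q ^ n * N (u - v)"
      by (simp add: mult_right_mono)
    moreover have "q ^ n * N (u - v) < q ^ n * N (b - c)"
      using less uv q_gt_1 by simp
    ultimately have "q ^ i * N (u - v) < q" "q ^ n * N (u - v) \<le> q"
      using n by linarith+
    then show ?thesis
      using N_iterate_diff_le[of u v b n i] uv assms that sim_iff iterate_closed by simp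
  qed
  then have "sim ((qmap b ^^ i) u) ((qmap b ^^ i) v)" for i
    using iterates_sim[OF assms(2,3) n uv(1,2)] by blast
  then have "u = v"
    using eq_if_iterates_close[of u v b] uv assms sim_iff iterate_closed by simp
  then show False
    using uv by simp
qed

text \<open>Applying \<open>N_param_diff_ge\<close> cyclically makes the three distances equal. The
  three images of \<open>x\<close> then all part at the same time, giving three mutually far
  points.\<close>

lemma no_three_params:
  assumes "x \<in> X" "b \<in> C" "c \<in> C" "d \<in> C" "b \<noteq> c" "c \<noteq> d" "b \<noteq> d"
  shows False
proof -
  have "N (b - c) \<le> N (c - d)" "N (c - d) \<le> N (d - b)" "N (d - b) \<le> N (b - c)"
    using N_param_diff_ge[OF assms(1)] assms(2-7) by auto
  then have eq: "N (c - d) = N (b - c)" "N (b - d) = N (b - c)"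
    using N_diff_commute[of b d] by linarith+
  define y where "y e = qmap e x" for e
  have y: "y b \<in> X" "y c \<in> X" "y d \<in> X" and diff: "y e - y e' = e - e'" for e e'
    using closed assms by (auto simp: y_def)
  have "y b \<noteq> y c"
    using assms by (simp add: y_def)
  then obtain n where "q ^ n * N (y b - y c) = q"
    using N_diff_power[OF y(1,2) assms(2)] by blast
  then have n: "q ^ n * N (b - c) = q"
    by (simp add: diff)
  let ?f = "\<lambda>e. (qmap b ^^ n) (y e)"
  have "N (?f e - ?f e') = q" if "y e \<in> X" "y e' \<in> X" "N (e - e') = N (b - c)" for e e'
    using N_iterate_diff_le[OF that(1,2) assms(2), of n n] that(3) n by (simp add: diff)
  then show False
    using no_three_far_points[of "?f b" "?f c" "?f d" b] iterate_closed y eq assms(2) by simp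
qed

end

section \<open>The p-adic norms on the rationals\<close>

definition padic_norm :: "nat \<Rightarrow> rat \<Rightarrow> real" where
  "padic_norm p x = (case quotient_of x of (a, b) \<Rightarrow>
     if a = 0 then 0 else real p powi (int (multiplicity (int p) b) - int (multiplicity (int p) a)))"

text \<open>Frees the norm from lowest terms; cross-multiplying two representations equates the sums
  of multiplicities.\<close>

lemma padic_norm_divide:
  assumes "prime p" "a \<noteq> 0" "b \<noteq> 0"
  shows "padic_norm p (of_int a / of_int b) =
    real p powi (int (multiplicity (int p) b) - int (multiplicity (int p) a))"
proof -
  obtain c d where cd: "quotient_of (of_int a / of_int b) = (c, d)"
    by fastforce
  then have "d > 0" and eq: "of_int a / of_int b = (of_int c / of_int d :: rat)"
    using quotient_of_denom_pos quotient_of_div by blast+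
  have "c \<noteq> 0"
    using eq assms \<open>d > 0\<close> by auto
  have "(of_int (a * d) :: rat) = of_int (c * b)"
    using eq assms \<open>d > 0\<close> by (simp add: field_simps)
  then have "a * d = c * b"
    by (simp only: of_int_eq_iff)
  then have "multiplicity (int p) (a * d) = multiplicity (int p) (c * b)"
    by simp
  then have "int (multiplicity (int p) a) + int (multiplicity (int p) d)
      = int (multiplicity (int p) c) + int (multiplicity (int p) b)"
    using assms \<open>c \<noteq> 0\<close> \<open>d > 0\<close> by (simp add: prime_elem_multiplicity_mult_distrib flip: of_nat_add)
  then have "int (multiplicity (int p) d) - int (multiplicity (int p) c)
      = int (multiplicity (int p) b) - int (multiplicity (int p) a)"
    by simp
  then show ?thesis
    using cd \<open>c \<noteq> 0\<close> by (simp add: padic_norm_def)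
qed

lemma padic_norm_of_int_le_1: "prime p \<Longrightarrow> padic_norm p (of_int a) \<le> 1"
  using padic_norm_divide[of p a 1] prime_gt_1_nat[of p]
  by (cases "a = 0") (auto simp: padic_norm_def power_int_minus inverse_le_1_iff)

lemma rat_cases_divide:
  fixes x :: rat
  obtains a b :: int where "b > 0" "x = of_int a / of_int b"
proof -
  obtain a b where "quotient_of x = (a, b)"
    by fastforce
  then show ?thesis
    using that quotient_of_denom_pos quotient_of_div by blast
qed

lemma padic_norm_mult:
  assumes "prime p"
  shows "padic_norm p (x * y) = padic_norm p x * padic_norm p y"
proof (cases "x = 0 \<or> y = 0")
  case False
  obtain a b where x: "x = of_int a / of_int b" "b > 0"
    by (rule rat_cases_divide)
  obtain c d where y: "y = of_int c / of_int d" "d > 0"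
    by (rule rat_cases_divide)
  have ne: "a \<noteq> 0" "b \<noteq> 0" "c \<noteq> 0" "d \<noteq> 0"
    using False x y by auto
  have xy: "x * y = of_int (a * c) / of_int (b * d)"
    by (simp add: x y)
  have "padic_norm p (x * y) =
      real p powi (int (multiplicity (int p) (b * d)) - int (multiplicity (int p) (a * c)))"
    unfolding xy by (rule padic_norm_divide) (use assms ne in auto)
  also have "int (multiplicity (int p) (b * d)) - int (multiplicity (int p) (a * c)) =
      (int (multiplicity (int p) b) - int (multiplicity (int p) a)) +
      (int (multiplicity (int p) d) - int (multiplicity (int p) c))"
    using assms ne by (simp add: prime_elem_multiplicity_mult_distrib)
  also have "real p powi \<dots> = padic_norm p x * padic_norm p y"
    using assms ne unfolding x y by (subst power_int_add) (auto simp: padic_norm_divide)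
  finally show ?thesis .
qed (auto simp: padic_norm_def)

lemma padic_norm_pos: "prime p \<Longrightarrow> x \<noteq> 0 \<Longrightarrow> padic_norm p x > 0"
  using prime_gt_0_nat[of p] by (auto simp: padic_norm_def split: prod.splits dest: quotient_of_div)

lemma padic_norm_0 [simp]: "padic_norm p 0 = 0"
  by (simp add: padic_norm_def)

lemma padic_norm_nonneg: "padic_norm p x \<ge> 0"
  by (auto simp: padic_norm_def split: prod.splits)

lemma padic_norm_add:
  assumes "prime p"
  shows "padic_norm p (x + y) \<le> max (padic_norm p x) (padic_norm p y)"
proof (cases "x = 0 \<or> y = 0 \<or> x + y = 0")
  case False
  obtain a b where x: "x = of_int a / of_int b" "b > 0"
    by (rule rat_cases_divide)
  obtain c d where y: "y = of_int c / of_int d" "d > 0"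
    by (rule rat_cases_divide)
  let ?m = "multiplicity (int p)"
  have "a \<noteq> 0" "c \<noteq> 0"
    using False x y by auto
  \<comment> \<open>Over a common denominator only the numerators matter, and a power of
    \<open>p\<close> dividing both divides their sum.\<close>
  have x': "x = of_int (a * d) / of_int (b * d)" and y': "y = of_int (c * b) / of_int (b * d)"
    using x y by simp_all
  have xy: "x + y = of_int (a * d + c * b) / of_int (b * d)"
    unfolding x' y' by (simp add: add_divide_distrib)
  have "a * d + c * b \<noteq> 0"
  proof
    assume "a * d + c * b = 0"
    with xy have "x + y = 0"
      by (simp only: of_int_0 div_0)
    with False show False
      by simp
  qed
  with \<open>a \<noteq> 0\<close> \<open>c \<noteq> 0\<close> x(2) y(2)
  have ne: "a * d \<noteq> 0" "b * d \<noteq> 0" "c * b \<noteq> 0" "a * d + c * b \<noteq> 0"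
    by simp_all
  have "min (?m (a * d)) (?m (c * b)) \<le> ?m (a * d + c * b)"
  proof (rule multiplicity_geI)
    show "int p ^ min (?m (a * d)) (?m (c * b)) dvd a * d + c * b"
      by (rule dvd_add; rule multiplicity_dvd', simp)
  qed (use ne assms in auto)
  then have disj: "?m (a * d) \<le> ?m (a * d + c * b) \<or> ?m (c * b) \<le> ?m (a * d + c * b)"
    by (simp add: min_le_iff_disj)
  have mono: "padic_norm p (of_int u / of_int (b * d)) \<le> padic_norm p (of_int v / of_int (b * d))"
    if "u \<noteq> 0" "v \<noteq> 0" "?m v \<le> ?m u" for u v
    unfolding padic_norm_divide[OF assms that(1) ne(2)] padic_norm_divide[OF assms that(2) ne(2)]
    using that(3) prime_gt_1_nat[OF assms] by (intro power_int_increasing) auto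
  have "padic_norm p (x + y) \<le> padic_norm p x \<or> padic_norm p (x + y) \<le> padic_norm p y"
    using disj mono[OF ne(4) ne(1)] mono[OF ne(4) ne(3)]
    unfolding xy[symmetric] x'[symmetric] y'[symmetric] by blast
  then show ?thesis
    by (simp only: le_max_iff_disj)
qed (auto simp: le_max_iff_disj padic_norm_nonneg)

text \<open>A prime dividing the reduced denominator does not divide the numerator, so the norm at
  that prime would exceed 1.\<close>

lemma Ints_if_padic_norm_le_1:
  assumes "\<And>p. prime p \<Longrightarrow> padic_norm p x \<le> 1"
  shows "x \<in> \<int>"
proof -
  obtain a b where ab: "quotient_of x = (a, b)"
    by fastforce
  then have x: "x = of_int a / of_int b" "b > 0" "coprime a b"
    using quotient_of_div quotient_of_denom_pos quotient_of_coprime by blast+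
  have "b = 1"
  proof (rule ccontr)
    assume "b \<noteq> 1"
    then have "\<not> is_unit b"
      using \<open>b > 0\<close> by (simp add: zdvd1_eq)
    then obtain q where "prime q" "q dvd b"
      using prime_divisor_exists[of b] \<open>b > 0\<close> by auto
    then obtain p where p: "q = int p" "prime p"
      using prime_int_nat_transfer[of q] prime_ge_0_int[of q] by (metis nat_0_le)
    have a: "\<not> int p dvd a"
      using \<open>coprime a b\<close> \<open>q dvd b\<close> \<open>prime q\<close> p by (metis coprime_common_divisor not_prime_unit)
    then have "a \<noteq> 0"
      by auto
    have "multiplicity (int p) b > 0" "multiplicity (int p) a = 0"
      using \<open>q dvd b\<close> p \<open>b > 0\<close> a by (auto simp: prime_multiplicity_gt_zero_iff not_dvd_imp_multiplicity_0)
    then have "padic_norm p x > 1"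
      using ab \<open>a \<noteq> 0\<close> prime_gt_1_nat[OF p(2)] by (simp add: padic_norm_def)
    then show False
      using assms[OF p(2)] by simp
  qed
  then show ?thesis
    using x by simp
qed

lemma nonarchimedean_padic_norm: "prime p \<Longrightarrow> nonarchimedean (padic_norm p)"
  by (rule nonarchimedean.intro) (simp_all add: padic_norm_pos padic_norm_mult padic_norm_add)

lemma padic_norm_of_int_eq_1: "prime p \<Longrightarrow> \<not> int p dvd a \<Longrightarrow> padic_norm p (of_int a) = 1"
  using padic_norm_divide[of p a 1] by (cases "a = 0") (auto simp: not_dvd_imp_multiplicity_0)

lemma padic_norm_two_eq_1:
  assumes "prime p" "p \<noteq> 2"
  shows "padic_norm p 2 = 1"
proof -
  have "\<not> int p dvd 2"
    using assms by (metis int_dvd_int_iff of_nat_numeral primes_dvd_imp_eq two_is_prime_nat)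
  then show ?thesis
    using padic_norm_of_int_eq_1[OF assms(1), of 2] by simp
qed

text \<open>The residue field at 2 has two elements: a 2-adic unit is a quotient of odd integers, so
  subtracting 1 leaves an even numerator.\<close>

lemma padic_norm_2_diff_one_le:
  assumes "padic_norm 2 u = 1"
  shows "padic_norm 2 (u - 1) \<le> padic_norm 2 2"
proof -
  interpret nonarchimedean "padic_norm 2"
    by (rule nonarchimedean_padic_norm) simp
  obtain a b where ab: "quotient_of u = (a, b)"
    by fastforce
  then have u: "u = of_int a / of_int b" "b > 0" "coprime a b"
    using quotient_of_div quotient_of_denom_pos quotient_of_coprime by blast+
  have "a \<noteq> 0"
    using assms u by auto
  then have "(2::real) powi (int (multiplicity 2 b) - int (multiplicity 2 a)) = 1"
    using assms padic_norm_divide[of 2 a b] u(1,2) by simp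
  then have "multiplicity 2 b = multiplicity 2 a"
    using power_int_strict_increasing[of 0 "int (multiplicity 2 b) - int (multiplicity 2 a)" "2::real"]
      power_int_strict_increasing[of "int (multiplicity 2 b) - int (multiplicity 2 a)" 0 "2::real"]
    by (cases "multiplicity 2 b" "multiplicity 2 a" rule: linorder_cases) auto
  then have "even a \<longleftrightarrow> even b"
    using \<open>a \<noteq> 0\<close> u(2) prime_multiplicity_gt_zero_iff[of "2::int"] by (metis less_irrefl two_is_prime prime_imp_prime_elem)
  then have odd: "odd a" "odd b"
    using u(3) by auto
  then obtain k where k: "a - b = 2 * k"
    by (metis dvd_def odd_even_add even_diff)
  have "padic_norm 2 (u - 1) = padic_norm 2 ((u - 1) * of_int b)"
    using padic_norm_of_int_eq_1[of 2 b] odd by (simp add: N_mult)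
  also have "(u - 1) * of_int b = 2 * of_int k"
    using u(1,2) k by (simp add: field_simps flip: of_int_diff of_int_mult)
  also have "padic_norm 2 (2 * of_int k) \<le> padic_norm 2 2 * 1"
    unfolding N_mult by (intro mult_left_mono padic_norm_of_int_le_1) auto
  finally show ?thesis by simp
qed

text \<open>Supplies \<open>N_diff_le\<close> of \<open>split_orbit\<close>. For odd
  \<open>p\<close> it is the ultrametric inequality; for \<open>p = 2\<close> the unit
  \<open>x / y\<close> is congruent to 1 modulo 2.\<close>

lemma padic_norm_diff_le_double:
  assumes "prime p" "padic_norm p x = padic_norm p y"
  shows "padic_norm p (x - y) \<le> padic_norm p (2 * x)"
proof -
  interpret nonarchimedean "padic_norm p"
    using assms(1) by (rule nonarchimedean_padic_norm)
  show ?thesis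
  proof (cases "p = 2 \<and> y \<noteq> 0")
    case True
    then have "padic_norm 2 (x / y) * padic_norm 2 y = padic_norm 2 y"
      using assms(2) N_mult[of "x / y" y] by simp
    then have "padic_norm 2 (x / y) = 1"
      using True N_pos[of y] by simp
    then have "padic_norm 2 (x / y - 1) * padic_norm 2 y \<le> padic_norm 2 2 * padic_norm 2 y"
      using padic_norm_2_diff_one_le by (intro mult_right_mono padic_norm_nonneg)
    moreover have "x - y = (x / y - 1) * y"
      using True by (simp add: field_simps)
    ultimately show ?thesis
      using True assms(2) N_mult by simp
  next
    case False
    then show ?thesis
      using assms N_diff[of x y] padic_norm_two_eq_1[OF assms(1)] by (auto simp: N_mult)
  qed
qed

section \<open>Finite invariant sets of rationals: integrality\<close>

locale rational_orbit =
  fixes X C :: "rat set"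
  assumes finite: "finite X"
    and nonempty: "X \<noteq> {}"
    and closed: "x \<in> X \<Longrightarrow> c \<in> C \<Longrightarrow> qmap c x \<in> X"
    and uminus_closed: "x \<in> X \<Longrightarrow> - x \<in> X"
begin

lemma padic_dichotomy:
  assumes "prime p" "c \<in> C"
  obtains "\<And>x y. x \<in> X \<Longrightarrow> y \<in> X \<Longrightarrow> padic_norm p (x - y) \<le> 1"
  | q where "split_orbit (padic_norm p) X C q"
proof -
  interpret nonarchimedean "padic_norm p"
    using assms(1) by (rule nonarchimedean_padic_norm)
  let ?N = "padic_norm p"
  show ?thesis
  proof (cases "\<exists>x\<in>X. ?N x > 1")
    case False
    then have "?N (x - y) \<le> 1" if "x \<in> X" "y \<in> X" for x y
      using that N_diff[of x y] by (meson max.boundedI not_le order.trans)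
    then show ?thesis by (rule that(1))
  next
    case True
    define R where "R = Max (?N ` X)"
    have le: "?N x \<le> R" if "x \<in> X" for x
      using that finite by (simp add: R_def)
    have "R \<in> ?N ` X"
      unfolding R_def using finite nonempty by (intro Max_in) auto
    then obtain z where z: "z \<in> X" "?N z = R"
      by auto
    have "R > 1"
      using True le by fastforce
    then have "R < R ^ 2"
      by (simp add: power2_eq_square)
    \<comment> \<open>\<open>x^2\<close> and \<open>- c\<close> differ by a point of
      \<open>X\<close>, of norm at most \<open>R < R^2\<close>. For \<open>z\<close> this fixes the
      norm of \<open>c\<close>, and then \<open>c\<close> fixes the norm of every point.\<close>
    have less: "?N (x\<^sup>2 - (- c)) < R\<^sup>2" if "x \<in> X" for x
      using le[OF closed[OF that assms(2)]] \<open>R < R ^ 2\<close> by simp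
    have "?N (- c) = R\<^sup>2"
    proof -
      have "?N (- c - z\<^sup>2) < ?N (z\<^sup>2)"
        unfolding N_diff_commute[of "- c"] using less[OF z(1)] z(2) by (simp add: N_power)
      then show ?thesis
        using N_close z(2) N_power by metis
    qed
    have eq: "?N x = R" if "x \<in> X" for x
    proof -
      have "?N (x\<^sup>2) = R\<^sup>2"
        using N_close[of "x\<^sup>2" "- c"] less[OF that] \<open>?N (- c) = R\<^sup>2\<close> by simp
      then show ?thesis
        using \<open>R > 1\<close> by (simp add: N_power power_eq_iff_eq_base)
    qed
    define q where "q = ?N (2 * z)"
    have diff: "?N (x - y) \<le> q" if "x \<in> X" "y \<in> X" for x y
      using padic_norm_diff_le_double[OF assms(1), of x y] eq that z by (simp add: q_def N_mult)
    show ?thesis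
    proof (cases "q > 1")
      case True
      have "split_orbit ?N X C q"
        by unfold_locales (use True closed uminus_closed diff eq z in \<open>auto simp: q_def N_mult\<close>)
      then show ?thesis by (rule that(2))
    next
      \<comment> \<open>For odd \<open>p\<close> this cannot occur, as then \<open>q = R\<close>;
        for \<open>p = 2\<close> it means \<open>R = 2\<close>.\<close>
      case False
      have "?N (x - y) \<le> 1" if "x \<in> X" "y \<in> X" for x y
        using diff[OF that] False by linarith
      then show ?thesis by (rule that(1))
    qed
  qed
qed

end

lemma Ints_pos_ge_1: "(r::rat) \<in> \<int> \<Longrightarrow> r > 0 \<Longrightarrow> r \<ge> 1"
  by (auto elim!: Ints_cases)

locale rational_orbit_three = rational_orbit +
  fixes c1 c2 c3 :: rat
  assumes params: "c1 \<in> C" "c2 \<in> C" "c3 \<in> C" and order: "c3 < c2" "c2 < c1"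
begin

lemma odd_padic_integral:
  assumes "prime p" "p \<noteq> 2" "x \<in> X" "y \<in> X"
  shows "padic_norm p (x - y) \<le> 1"
  using assms(1) params(1)
proof (cases rule: padic_dichotomy)
  case (2 q)
  then interpret odd_split_orbit "padic_norm p" X C q
    using padic_norm_two_eq_1[OF assms(1,2)]
    by (simp add: odd_split_orbit_def odd_split_orbit_axioms_def)
  show ?thesis
    using no_three_params[OF assms(3) params] order by auto
qed (use assms in auto)

text \<open>At 2 the points are in equal or opposite discs, so the difference or the sum is integral
  there; at odd primes both are.\<close>

lemma diff_or_sum_Ints:
  assumes "x \<in> X" "y \<in> X"
  shows "x - y \<in> \<int> \<or> x + y \<in> \<int>"
proof -
  have odd: "padic_norm p (x - y) \<le> 1 \<and> padic_norm p (x + y) \<le> 1" if "prime p" "p \<noteq> 2" for p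
    using odd_padic_integral[OF that, of x y] odd_padic_integral[OF that, of x "- y"]
      uminus_closed assms by simp
  have "padic_norm 2 (x - y) \<le> 1 \<or> padic_norm 2 (x + y) \<le> 1"
    using two_is_prime_nat params(1)
  proof (cases rule: padic_dichotomy)
    case (2 q)
    then interpret split_orbit "padic_norm 2" X C q .
    show ?thesis
      using N_diff_le_1[OF assms _ params(1)] N_sum_le_1[OF assms _ params(1)] N_diff_le[OF assms]
      by linarith
  qed (use assms in auto)
  then show ?thesis
    using odd Ints_if_padic_norm_le_1 by metis
qed

text \<open>Take the three images of one point. If no two parameters differ by an integer, all
  pairwise sums of the images are integers, and subtracting two of these sums gives an integral
  parameter difference.\<close>

lemma param_range_ge_1: "c1 - c3 \<ge> 1"
proof -
  obtain x where "x \<in> X"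
    using nonempty by auto
  then have X: "qmap c1 x \<in> X" "qmap c2 x \<in> X" "qmap c3 x \<in> X"
    using closed params by auto
  have "c1 - c2 \<in> \<int> \<or> c1 - c3 \<in> \<int> \<or> c2 - c3 \<in> \<int>"
  proof (rule ccontr)
    assume *: "\<not> ?thesis"
    then have "qmap c1 x + qmap c2 x \<in> \<int>" "qmap c1 x + qmap c3 x \<in> \<int>"
      using diff_or_sum_Ints[OF X(1,2)] diff_or_sum_Ints[OF X(1,3)] by auto
    then have "(qmap c1 x + qmap c2 x) - (qmap c1 x + qmap c3 x) \<in> \<int>"
      by (rule Ints_diff)
    then show False
      using * by simp
  qed
  then show ?thesis
    using Ints_pos_ge_1[of "c1 - c2"] Ints_pos_ge_1[of "c1 - c3"] Ints_pos_ge_1[of "c2 - c3"] order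
    by force
qed

end

section \<open>Real estimates and classification\<close>

text \<open>The least point that is moved down would be sent to a smaller point that is also moved
  down; dually for points moved up.\<close>

lemma strict_mono_on_finite_fixes:
  fixes A :: "'a::linorder set"
  assumes "finite A" "strict_mono_on A g" "g ` A \<subseteq> A" "x \<in> A"
  shows "g x = x"
proof (rule linorder_cases[of "g x" x])
  assume "g x < x"
  let ?B = "{y \<in> A. g y < y}"
  have B: "finite ?B" "?B \<noteq> {}"
    using assms \<open>g x < x\<close> by auto
  then have "Min ?B \<in> ?B"
    by (rule Min_in)
  then have "g (Min ?B) \<in> ?B" "g (Min ?B) < Min ?B"
    using assms by (auto simp: strict_mono_on_def)
  then show ?thesis
    using Min_le[OF B(1)] by (meson not_le)
next
  assume "x < g x"
  let ?B = "{y \<in> A. y < g y}"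
  have B: "finite ?B" "?B \<noteq> {}"
    using assms \<open>x < g x\<close> by auto
  then have "Max ?B \<in> ?B"
    by (rule Max_in)
  then have "g (Max ?B) \<in> ?B" "Max ?B < g (Max ?B)"
    using assms by (auto simp: strict_mono_on_def)
  then show ?thesis
    using Max_ge[OF B(1)] by (meson not_le)
qed

context rational_orbit_three
begin

lemma abs_closed: "x \<in> X \<Longrightarrow> \<bar>x\<bar> \<in> X"
  using uminus_closed by (auto simp: abs_if)

lemma extremal_points:
  obtains m M where "m \<in> X" "M \<in> X" "0 \<le> m" "m < M" "\<And>x. x \<in> X \<Longrightarrow> m \<le> \<bar>x\<bar> \<and> \<bar>x\<bar> \<le> M"
proof -
  let ?A = "abs ` X"
  have A: "finite ?A" "?A \<noteq> {}" "?A \<subseteq> X"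
    using finite nonempty abs_closed by auto
  have in_A: "Min ?A \<in> ?A" "Max ?A \<in> ?A"
    using A by auto
  have bounds: "Min ?A \<le> \<bar>x\<bar> \<and> \<bar>x\<bar> \<le> Max ?A" if "x \<in> X" for x
    using that A by auto
  have "Min ?A \<noteq> Max ?A"
  proof
    assume "Min ?A = Max ?A"
    then have eq: "\<bar>x\<bar> = Max ?A" if "x \<in> X" for x
      using bounds[OF that] by simp
    obtain x where "x \<in> X"
      using nonempty by auto
    then have "\<bar>qmap c1 x\<bar> = Max ?A" "\<bar>qmap c2 x\<bar> = Max ?A" "\<bar>qmap c3 x\<bar> = Max ?A"
      using closed params eq by auto
    then show False
      using order by linarith
  qed
  moreover have "Min ?A \<le> Max ?A"
    using in_A A(1) by (intro Min_le) auto
  ultimately have "Min ?A < Max ?A"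
    by simp
  moreover have "0 \<le> Min ?A"
    using in_A(1) by auto
  ultimately show ?thesis
    using that in_A A(3) bounds by blast
qed

text \<open>If \<open>qmap c1\<close> is nonnegative on \<open>X\<close>, then it maps the nonnegative part of \<open>X\<close>
  to itself in a strictly increasing way, hence fixes it pointwise.\<close>
lemma opposite_sign_case:
  assumes mM: "m \<in> X" "M \<in> X" "0 \<le> m" "m < M"
    and sign: "\<And>x. x \<in> X \<Longrightarrow> 0 \<le> qmap c1 x"
  shows "c1 = 3/16 \<and> c2 = -5/16 \<and> c3 = -13/16 \<and> (\<forall>x\<in>X. x \<in> {1/4, -1/4, 3/4, -3/4})"
proof -
  let ?A = "X \<inter> {0..}"
  have fixed: "qmap c1 x = x" if "x \<in> ?A" for x
  proof (rule strict_mono_on_finite_fixes[OF _ _ _ that])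
    show "strict_mono_on ?A (qmap c1)"
      by (auto simp: strict_mono_on_def power_strict_mono)
  qed (use finite closed params sign in auto)
  have root: "x = m \<or> x = 1 - m" if "x \<in> ?A" for x
  proof -
    have "(x - m) * (x + m - 1) = 0"
      using fixed[OF that] fixed[of m] mM by (simp add: algebra_simps power2_eq_square)
    then show ?thesis
      by auto
  qed
  have M: "M = 1 - m"
    using root[of M] mM by auto
  have four: "x \<in> {m, - m, M, - M}" if "x \<in> X" for x
    using root[of "\<bar>x\<bar>"] abs_closed[OF that] M by (auto simp: abs_if split: if_splits)
  have c1: "c1 = m - m\<^sup>2"
    using fixed[of m] mM by simp
  have X: "qmap c2 m \<in> X" "qmap c3 m \<in> X" "qmap c2 M \<in> X"
    using closed params mM by auto
  have "qmap c2 m < m" "qmap c3 m < qmap c2 m"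
    using c1 order by auto
  \<comment> \<open>Two distinct values below \<open>m\<close> must be found among \<open>m\<close>,
    \<open>- m\<close>, \<open>M\<close>, \<open>- M\<close>.\<close>
  then have "qmap c2 m = - m" "qmap c3 m = - M"
    using four[OF X(1)] four[OF X(2)] mM by auto
  then have c2: "c2 = - m - m\<^sup>2" and c3: "c3 = - M - m\<^sup>2"
    by auto
  have "m \<noteq> 0"
    using \<open>qmap c2 m < m\<close> \<open>qmap c2 m = - m\<close> by auto
  have "qmap c2 M = 1 - 3 * m"
    by (simp add: c2 M power2_eq_square algebra_simps)
  \<comment> \<open>Equating \<open>1 - 3 * m\<close> with each of the four points gives
    \<open>m\<close> equal to 1/4, 1/2 or 0, and \<open>m < M = 1 - m\<close> excludes 1/2.\<close>
  then have m: "m = 1/4"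
    using four[OF X(3)] mM M \<open>m \<noteq> 0\<close> by auto
  show ?thesis
    using four by (simp add: c1 c2 c3 M m power2_eq_square)
qed

text \<open>Two points of \<open>X\<close> of equal sign at distance at least \<open>1\<close> force all the estimates
  for the extreme maps at the extreme points to be sharp.\<close>
lemma equal_sign_case:
  assumes mM: "m \<in> X" "M \<in> X" "0 \<le> m" "m < M"
    and bounds: "\<And>x. x \<in> X \<Longrightarrow> m \<le> \<bar>x\<bar> \<and> \<bar>x\<bar> \<le> M"
    and gap: "m + (c1 - c3) \<le> M"
  shows "c1 = -5/16 \<and> c2 = -13/16 \<and> c3 = -21/16 \<and>
    (\<forall>x\<in>X. x \<in> {1/4, -1/4, 3/4, -3/4, 5/4, -5/4})"
proof -
  have "qmap c1 M \<in> X" "qmap c3 m \<in> X"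
    using closed params mM by auto
  from bounds[OF this(1)] bounds[OF this(2)]
  have ub: "M\<^sup>2 + c1 \<le> M" and lb: "- M \<le> m\<^sup>2 + c3"
    by auto
  have "m \<le> M - 1"
    using gap param_range_ge_1 by linarith
  then have "m\<^sup>2 \<le> (M - 1)\<^sup>2"
    using mM(3) by (intro power_mono)
  moreover have "(M - 1)\<^sup>2 = M\<^sup>2 - 2 * M + 1"
    by (simp add: power2_eq_square algebra_simps)
  \<comment> \<open>The chain \<open>- M - c3 <= m^2 <= (M - 1)^2 <= 1 - M - c1\<close> gives
    \<open>c1 - c3 <= 1\<close>; with \<open>param_range_ge_1\<close> every inequality in it becomes
    an equality.\<close>
  ultimately have diff: "c1 - c3 = 1" and sharp: "m\<^sup>2 = (M - 1)\<^sup>2" "M\<^sup>2 + c1 = M" "- M = m\<^sup>2 + c3"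
    using ub lb param_range_ge_1 by linarith+
  have M: "M = m + 1"
  proof -
    have "m = M - 1 \<or> m = - (M - 1)"
      using sharp(1) unfolding power2_eq_iff .
    then show ?thesis
      using \<open>m \<le> M - 1\<close> mM(3) by linarith
  qed
  define t where "t = c1 - c2"
  have "qmap c2 M \<in> X" "- qmap c2 m \<in> X"
    by (intro uminus_closed closed mM params)+
  moreover have "qmap c2 M = M - t" "- qmap c2 m = M - (1 - t)"
    using sharp diff by (auto simp: t_def)
  ultimately have X: "M - t \<in> X" "M - (1 - t) \<in> X"
    by auto
  have t: "0 < t" "t < 1"
    using order diff by (auto simp: t_def)
  \<comment> \<open>Comparing \<open>M\<close> with \<open>M - t\<close> and
    \<open>M - (1 - t)\<close>: either a difference, \<open>t\<close> or \<open>1 - t\<close>, is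
    integral, or both sums are, and these differ by \<open>2 * t - 1\<close>.\<close>
  have "2 * t \<in> \<int>"
  proof -
    have "M - (M - u) = u" "M + (M - u) = 2 * M - u" for u
      by simp_all
    then consider "t \<in> \<int>" | "1 - t \<in> \<int>" | "2 * M - t \<in> \<int>" "2 * M - (1 - t) \<in> \<int>"
      using diff_or_sum_Ints[OF mM(2) X(1)] diff_or_sum_Ints[OF mM(2) X(2)] by metis
    then show ?thesis
    proof cases
      case 1
      then show ?thesis
        by simp
    next
      case 2
      then have "2 - 2 * (1 - t) \<in> \<int>"
        by (intro Ints_diff Ints_mult) auto
      then show ?thesis
        by simp
    next
      case 3
      have "(2 * M - (1 - t)) - (2 * M - t) + 1 \<in> \<int>"
        by (rule Ints_add[OF Ints_diff[OF 3(2,1)] Ints_1])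
      then show ?thesis
        by simp
    qed
  qed
  then obtain z where z: "2 * t = of_int z"
    by (rule Ints_cases)
  with t have "0 < (of_int z :: rat)" "(of_int z :: rat) < 2"
    by linarith+
  then have "z = 1"
    by simp
  with z have t: "t = 1/2"
    by simp
  \<comment> \<open>This anchors \<open>X\<close>: by \<open>diff_or_sum_Ints\<close> every point is
    then 1/4 or -1/4 modulo 1.\<close>
  have "qmap c1 (M - t) = 1/4"
    using sharp(2) by (simp add: t power2_eq_square algebra_simps)
  then have quarter: "1/4 \<in> X"
    using closed[OF X(1) params(1)] by (simp only:)
  have mem: "x \<in> {1/4, -1/4, 3/4, -3/4, 5/4, -5/4}" if "x \<in> X" for x
  proof -
    have "\<bar>x\<bar> \<le> 5/4"
      using bounds[OF that] bounds[OF quarter] M by auto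
    then have x: "x \<le> 5/4" "- (5/4) \<le> x"
      by auto
    from diff_or_sum_Ints[OF that quarter] consider k :: int where "x = of_int k + 1/4"
      | k :: int where "x = of_int k - 1/4"
      by (auto elim!: Ints_cases simp: algebra_simps)
    then show ?thesis
    proof cases
      case (1 k)
      then have "k \<le> 1" "-1 \<le> k"
        using x by linarith+
      then have "k = -1 \<or> k = 0 \<or> k = 1"
        by linarith
      then show ?thesis
        using 1 by auto
    next
      case (2 k)
      then have "k \<le> 1" "-1 \<le> k"
        using x by linarith+
      then have "k = -1 \<or> k = 0 \<or> k = 1"
        by linarith
      then show ?thesis
        using 2 by auto
    qed
  qed
  have "m \<le> 1/4"
    using bounds[OF quarter] by simp
  then have "m = 1/4"
    using mem[OF mM(1)] mM(3) by auto
  then have M: "M = 5/4"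
    using M by simp
  have "c1 = M - M\<^sup>2"
    using sharp(2) by linarith
  then have "c1 = -5/16"
    unfolding M by (simp add: power2_eq_square)
  then show ?thesis
    using mem diff t by (auto simp: t_def)
qed

lemma classification:
  "(c1 = -5/16 \<and> c2 = -13/16 \<and> c3 = -21/16 \<and>
      (\<forall>x\<in>X. x \<in> {1/4, -1/4, 3/4, -3/4, 5/4, -5/4})) \<or>
   (c1 = 3/16 \<and> c2 = -5/16 \<and> c3 = -13/16 \<and> (\<forall>x\<in>X. x \<in> {1/4, -1/4, 3/4, -3/4}))"
proof -
  obtain m M where mM: "m \<in> X" "M \<in> X" "0 \<le> m" "m < M"
    and bounds: "\<And>x. x \<in> X \<Longrightarrow> m \<le> \<bar>x\<bar> \<and> \<bar>x\<bar> \<le> M"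
    by (rule extremal_points) blast
  show ?thesis
  proof (cases "\<forall>x\<in>X. 0 \<le> qmap c1 x")
    case True
    then show ?thesis
      using opposite_sign_case[OF mM] by blast
  next
    case False
    then obtain x where x: "x \<in> X" "qmap c1 x < 0"
      by auto
    then have "qmap c1 x \<in> X" "qmap c3 x \<in> X"
      using closed params by auto
    \<comment> \<open>Both images are negative and differ by \<open>c1 - c3\<close>, so their
      absolute values differ by as much.\<close>
    from bounds[OF this(1)] bounds[OF this(2)] x(2) have "m + (c1 - c3) \<le> M"
      using order by linarith
    then show ?thesis
      using equal_sign_case[OF mM bounds] by blast
  qed
qed

end

section \<open>Return to orbits of rational functions\<close>

lemma ratfun_map_quad: "ratfun_map (quad c) (Affine x) = Affine (qmap c x)"
  by (simp add: ratfun_map_def quad_def power2_eq_square add.commute)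

lemma inj_quad: "inj quad"
  by (auto simp: inj_def quad_def)

text \<open>\<open>P\<close> is adjoined because the monoid has no identity in general; negatives
  can be adjoined because every \<open>qmap c\<close> is even.\<close>

lemma finite_orbit_subset_rational_orbit:
  assumes "has_finite_orbit (quad ` C) (Affine P)"
  obtains X where "rational_orbit X C" "P \<in> X"
proof -
  let ?S = "quad ` C"
  define Y where "Y = insert P {x. Affine x \<in> orbit_of ?S (Affine P)}"
  have "{x. Affine x \<in> orbit_of ?S (Affine P)} = Affine -` orbit_of ?S (Affine P)"
    by auto
  then have "finite Y"
    using assms by (simp add: Y_def has_finite_orbit_def finite_vimageI inj_def)
  have Y: "qmap c y \<in> Y" if y: "y \<in> Y" and c: "c \<in> C" for y c
  proof -
    have "\<exists>\<rho>\<in>comp_monoid ?S. \<rho> (Affine P) = Affine (qmap c y)"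
    proof (cases "y = P")
      case True
      then show ?thesis
        using c comp_monoid.generator[of "quad c" ?S] ratfun_map_quad by blast
    next
      case False
      then obtain \<rho> where "\<rho> \<in> comp_monoid ?S" "Affine y = \<rho> (Affine P)"
        using y by (auto simp: Y_def orbit_of_def)
      then show ?thesis
        using c comp_monoid.compose[of "quad c" ?S \<rho>] ratfun_map_quad
        by (metis comp_apply image_eqI)
    qed
    then show ?thesis
      by (fastforce simp: Y_def orbit_of_def)
  qed
  have "rational_orbit (Y \<union> uminus ` Y) C"
  proof
    fix x c
    assume x: "x \<in> Y \<union> uminus ` Y" and c: "c \<in> C"
    then obtain y where "y \<in> Y" "x\<^sup>2 = y\<^sup>2"
      by auto
    then show "qmap c x \<in> Y \<union> uminus ` Y"
      using Y[OF _ c] by simp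
  next
    show "Y \<union> uminus ` Y \<noteq> {}"
      by (simp add: Y_def)
  qed (use \<open>finite Y\<close> in auto)
  then show ?thesis
    by (rule that) (simp add: Y_def)
qed

lemma three_params_classification:
  assumes "has_finite_orbit (quad ` C) (Affine P)"
    and "c1 \<in> C" "c2 \<in> C" "c3 \<in> C" "c3 < c2" "c2 < c1"
  shows "(c1 = -5/16 \<and> c2 = -13/16 \<and> c3 = -21/16 \<and> P \<in> {1/4, -1/4, 3/4, -3/4, 5/4, -5/4}) \<or>
    (c1 = 3/16 \<and> c2 = -5/16 \<and> c3 = -13/16 \<and> P \<in> {1/4, -1/4, 3/4, -3/4})"
proof -
  obtain X where "rational_orbit X C" "P \<in> X"
    using finite_orbit_subset_rational_orbit[OF assms(1)] .
  then interpret rational_orbit_three X C c1 c2 c3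
    using assms by (simp add: rational_orbit_three_def rational_orbit_three_axioms_def)
  show ?thesis
    using classification \<open>P \<in> X\<close> by blast
qed

theorem theorem1p1:
  fixes s :: nat and c :: "nat \<Rightarrow> rat" and S :: "ratfun set"
  assumes "s \<ge> 1"
    and "inj_on c {1..s}"
    and "S = (\<lambda>i. quad (c i)) ` {1..s}"
    and "max_period S \<le> 3"
  shows "(card S = 3 \<longrightarrow>
           (\<forall>P :: rat. has_finite_orbit S (Affine P) \<longrightarrow>
              (S = {quad (-5/16), quad (-13/16), quad (-21/16)} \<and>
                 P \<in> {1/4, -1/4, 3/4, -3/4, 5/4, -5/4}) \<or>
              (S = {quad (3/16), quad (-5/16), quad (-13/16)} \<and>
                 P \<in> {1/4, -1/4, 3/4, -3/4}))) \<and>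
         (card S \<ge> 4 \<longrightarrow>
           \<not> (\<exists>P :: rat. has_finite_orbit S (Affine P)))"
proof -
  define C where "C = c ` {1..s}"
  have S: "S = quad ` C"
    by (auto simp: assms(3) C_def)
  have card: "card S = card C"
    unfolding S by (rule card_image) (rule inj_on_subset[OF inj_quad subset_UNIV])
  have fin: "finite C"
    by (simp add: C_def)
  \<comment> \<open>The list is increasing, so for \<open>i < j < k\<close> the entries
    \<open>k\<close>, \<open>j\<close>, \<open>i\<close> serve as \<open>c1\<close>,
    \<open>c2\<close>, \<open>c3\<close>.\<close>
  define xs where "xs = sorted_list_of_set C"
  have xs: "set xs = C" "length xs = card S"
    using fin card by (auto simp: xs_def)
  have less: "xs ! i < xs ! j" if "i < j" "j < card S" for i j
    using that xs sorted_wrt_nth_less[OF strict_sorted_list_of_set[of C]] by (simp add: xs_def)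
  have mem: "xs ! i \<in> C" if "i < card S" for i
    using that xs by (metis nth_mem)
  have triple: "(xs ! k = -5/16 \<and> xs ! j = -13/16 \<and> xs ! i = -21/16 \<and>
        P \<in> {1/4, -1/4, 3/4, -3/4, 5/4, -5/4}) \<or>
      (xs ! k = 3/16 \<and> xs ! j = -5/16 \<and> xs ! i = -13/16 \<and> P \<in> {1/4, -1/4, 3/4, -3/4})"
    if "has_finite_orbit S (Affine P)" "i < j" "j < k" "k < card S" for P i j k
    using that by (intro three_params_classification[of C] mem less) (simp_all add: S)
  show ?thesis
  proof (intro conjI impI allI notI)
    fix P
    assume three: "card S = 3" and P: "has_finite_orbit S (Affine P)"
    have "C = (!) xs ` {..<3}"
      using xs three by (auto simp: set_conv_nth)
    also have "{..<3} = {2, 1, 0::nat}"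
      by auto
    finally have S: "S = {quad (xs ! 2), quad (xs ! 1), quad (xs ! 0)}"
      unfolding S by simp
    have "0 < (1::nat)" "1 < (2::nat)" "2 < card S"
      using three by simp_all
    from triple[OF P this]
    show "(S = {quad (-5/16), quad (-13/16), quad (-21/16)} \<and>
          P \<in> {1/4, -1/4, 3/4, -3/4, 5/4, -5/4}) \<or>
        (S = {quad (3/16), quad (-5/16), quad (-13/16)} \<and> P \<in> {1/4, -1/4, 3/4, -3/4})"
      unfolding S by (elim disjE conjE) (simp_all only: simp_thms)
  next
    assume four: "card S \<ge> 4" and "\<exists>P. has_finite_orbit S (Affine P)"
    then obtain P where P: "has_finite_orbit S (Affine P)"
      by auto
    have "1 < (2::nat)" "0 < (2::nat)" "2 < (3::nat)" "3 < card S"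
      using four by simp_all
    \<comment> \<open>The triples with indices \<open>0, 2, 3\<close> and \<open>1, 2, 3\<close>
      share their largest entry, which determines the smallest in the classification.\<close>
    from triple[OF P this(1,3,4)] triple[OF P this(2,3,4)] have "xs ! 0 = xs ! 1"
      by (elim disjE conjE) simp_all
    then show False
      using less[of 0 1] four by simp
  qed
qed

end
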